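(* For every integer $n\ge 1$, $$\int_0^1\int_0^1\cdots\int_0^1 \log\Gamma(x_1+x_2+\dots+x_n)\,dx_1\,dx_2\cdots dx_n=\frac12\log(2\pi)-\frac{n-1}{2}H_n+\sum_{k=2}^{n-1}\frac{(-1)^{n+k+1}k^n}{n!}\binom{n-1}{k}\log k,$$ where $H_n=\sum_{k=1}^{n}\frac1k$.
   Context: $\Gamma$ is the Euler Gamma function and $\log$ is the natural logarithm. An empty sum (when $n\le 2$) equals $0$. *)

theory Defs
  imports "HOL-Analysis.Analysis"
begin

text \<open>Lebesgue measure on the unit cube \<open>[0,1]\<^sup>n\<close>. Since \<open>n\<close> is a natural number rather than
  a type, points are functions on the index set \<open>{1..n}\<close>.\<close>

abbreviation unit_cube :: "nat \<Rightarrow> (nat \<Rightarrow> real) measure" where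
  "unit_cube n \<equiv> (\<Pi>\<^sub>M i\<in>{1..n}. restrict_space lborel {0..1})"

end

(* Raabe's formula integrates log Gamma over a unit interval [a,a+1] to a log a - a + log(2 pi)/2.
   It holds up to a constant because log Gamma(a+1) - log Gamma(a) = log a, and Legendre's
   duplication formula, integrated over [0,1/2], gives the constant. Integrating out one variable
   thus leaves, up to that constant, the integral of s log s - s over the cube of dimension m = n - 1. Each further
   integration replaces a function by the difference of an antiderivative, so this integral is the
   m-th forward difference at 0 of the m-th iterated antiderivative
   s^(m+1) (log s - H_(m+1)) / (m+1)!. *)
theory Submission
  imports Defs
begin

subsection \<open>Raabe's formula\<close>

text \<open>Only 0 is critical. There one factor \<open>x\<close> absorbs the logarithm: inversion
  turns x log x at 0 into -(log x)/x at infinity, which tends to 0. This makes the antiderivatives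
  below continuous up to 0.\<close>

lemma continuous_on_power_mult_ln: "continuous_on {0..} (\<lambda>x::real. x ^ Suc j * ln x)"
proof -
  have 1: "((\<lambda>x::real. x * ln x) \<longlongrightarrow> 0) (at_right 0)"
  proof -
    have "((\<lambda>x::real. - (ln x / x)) \<longlongrightarrow> 0) at_top"
      using tendsto_minus[OF ln_x_over_x_tendsto_0] by simp
    moreover have "eventually (\<lambda>x::real. - (ln x / x) = inverse x * ln (inverse x)) at_top"
      using eventually_gt_at_top[of 0] by eventually_elim (simp add: ln_inverse divide_inverse mult.commute)
    ultimately have "((\<lambda>x::real. inverse x * ln (inverse x)) \<longlongrightarrow> 0) at_top"
      by (rule Lim_transform_eventually)
    then show ?thesis
      unfolding filterlim_at_right_to_top .
  qed
  have "continuous (at x within {0..}) (\<lambda>x::real. x * ln x)" if "x \<in> {0..}" for x :: real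
  proof (cases "x = 0")
    case True
    have "at (0::real) within {0..} = at_right 0"
      by (simp add: at_within_Ici_at_right)
    with 1 True show ?thesis by (simp add: continuous_within)
  next
    case False
    with that show ?thesis by (auto intro!: continuous_intros)
  qed
  then have "continuous_on {0..} (\<lambda>x::real. x * ln x)"
    by (simp add: continuous_on_eq_continuous_within)
  then have "continuous_on {0..} (\<lambda>x::real. x ^ j * (x * ln x))"
    by (rule continuous_on_mult[rotated]) (intro continuous_intros)
  then show ?thesis by (simp only: power_Suc2 mult.assoc)
qed

text \<open>The functional equation isolates the singularity of log Gamma at 0 in the term
  \<open>- ln x\<close>. At \<open>x = 0\<close> the conventions \<open>Gamma 0 = 0\<close> and
  \<open>ln 0 = 0\<close> make both sides 0.\<close>

lemma ln_Gamma_eq: "x \<ge> 0 \<Longrightarrow> ln (Gamma x) = ln (Gamma (x + 1)) - ln (x :: real)"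
proof (cases "x = 0")
  case False
  moreover assume "x \<ge> 0"
  ultimately have "x > 0" by simp
  then have "Gamma (x + 1) = x * Gamma x"
    by (intro Gamma_plus1) (auto elim!: nonpos_Ints_cases)
  with \<open>x > 0\<close> show ?thesis
    by (simp add: ln_mult less_imp_neq[OF Gamma_real_pos, symmetric])
qed simp

lemma continuous_on_ln_Gamma_Suc: "continuous_on {0..} (\<lambda>x::real. ln (Gamma (x + 1)))"
proof (intro continuous_on_ln continuous_on_compose2[OF continuous_on_Gamma[of "{0<..}"]]
    continuous_intros)
  show "\<forall>x\<in>{0..}. Gamma (x + 1) \<noteq> (0::real)"
    by (intro ballI less_imp_neq[OF Gamma_real_pos, symmetric]) auto
qed (auto elim!: nonpos_Ints_cases)

text \<open>Differentiability is asked for on the open half-line only, so integrands unbounded at 0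
  may be integrated from 0 on.\<close>

lemma has_real_derivative_imp_has_integral:
  fixes f :: "real \<Rightarrow> real"
  assumes "continuous_on {0..} F" "\<And>x. x > 0 \<Longrightarrow> (F has_real_derivative f x) (at x)"
    and "0 \<le> a" "a \<le> b"
  shows "(f has_integral F b - F a) {a..b}"
proof (rule fundamental_theorem_of_calculus_interior)
  show "continuous_on {a..b} F"
    using assms by (auto intro: continuous_on_subset)
qed (use assms in \<open>auto simp: has_real_derivative_iff_has_vector_derivative[symmetric]\<close>)

lemma ln_Gamma_antiderivative:
  obtains L where "continuous_on {0..} L"
    "\<And>x. x > 0 \<Longrightarrow> (L has_real_derivative ln (Gamma x)) (at x)"
proof
  define g where "g = (\<lambda>x::real. ln (Gamma (x + 1)))"
  \<comment> \<open>\<open>ln (Gamma x) = g x - ln x\<close>: the continuous part \<open>g\<close>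
    is integrated from 0, and \<open>ln\<close> has the antiderivative x log x - x. Writing
    \<open>x ^ Suc 0\<close> fits \<open>continuous_on_power_mult_ln\<close>.\<close>
  define L where "L = (\<lambda>x. integral {0..x} g - (x ^ Suc 0 * ln x - x))"
  have cont: "continuous_on {0..b} g" for b
    unfolding g_def by (rule continuous_on_subset[OF continuous_on_ln_Gamma_Suc]) auto
  have der: "((\<lambda>x. integral {0..x} g) has_real_derivative g x) (at x within {0..})"
    if "x \<ge> 0" for x
  proof -
    have "((\<lambda>x. integral {0..x} g) has_real_derivative g x) (at x within {0..x+1})"
      using integral_has_real_derivative[OF cont, of x "x + 1"] that by auto
    also have "at x within {0..x+1} = at x within {0..}"
      using that by (intro at_within_nhd[where S = "{..<x+1}"]) auto
    finally show ?thesis .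
  qed
  then have "continuous_on {0..} (\<lambda>x. integral {0..x} g)"
    by (meson DERIV_continuous_on atLeast_iff)
  then show "continuous_on {0..} L"
    unfolding L_def by (intro continuous_intros continuous_on_power_mult_ln)
  show "(L has_real_derivative ln (Gamma x)) (at x)" if "x > 0" for x
  proof -
    have "at x within {0..} = at x"
      using that by (intro at_within_interior) auto
    with der[of x] that have "((\<lambda>x. integral {0..x} g) has_real_derivative g x) (at x)"
      by simp
    then show ?thesis
      unfolding L_def using that ln_Gamma_eq[of x]
      by (auto intro!: derivative_eq_intros simp: g_def)
  qed
qed

lemma ln_Gamma_legendre_duplication:
  fixes x :: real
  assumes "x > 0"
  shows "ln (Gamma x) + ln (Gamma (x + 1/2)) = (1 - 2 * x) * ln 2 + ln pi / 2 + ln (Gamma (2 * x))"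
proof -
  \<comment> \<open>The identity is taken from the complex Gamma function and pulled back by
    injectivity of \<open>of_real\<close>.\<close>
  let ?z = "complex_of_real x"
  have "?z \<notin> \<int>\<^sub>\<le>\<^sub>0" "complex_of_real (x + 1/2) \<notin> \<int>\<^sub>\<le>\<^sub>0"
    using assms by (simp_all only: of_real_in_nonpos_Ints_iff) (auto elim!: nonpos_Ints_cases)
  then have "Gamma ?z * Gamma (?z + 1/2) =
      exp ((1 - 2*?z) * of_real (ln 2)) * of_real (sqrt pi) * Gamma (2*?z)"
    by (intro Gamma_legendre_duplication) auto
  also have "?z + 1/2 = of_real (x + 1/2)" by simp
  also have "2 * ?z = of_real (2 * x)" by simp
  also have "1 - complex_of_real (2 * x) = of_real (1 - 2 * x)" by simp
  finally have "complex_of_real (Gamma x * Gamma (x + 1/2)) =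
      of_real (exp ((1 - 2*x) * ln 2) * sqrt pi * Gamma (2*x))"
    unfolding Gamma_complex_of_real by (simp only: of_real_mult [symmetric] exp_of_real)
  then have "Gamma x * Gamma (x + 1/2) = exp ((1 - 2*x) * ln 2) * sqrt pi * Gamma (2*x)"
    by (simp only: of_real_eq_iff)
  then have "ln (Gamma x * Gamma (x + 1/2)) = ln (exp ((1 - 2*x) * ln 2) * sqrt pi * Gamma (2*x))"
    by simp
  moreover have "Gamma x > 0" "Gamma (x + 1/2) > 0" "Gamma (2*x) > 0"
    using assms by auto
  ultimately show ?thesis
    by (simp add: ln_mult ln_sqrt less_imp_neq[symmetric] del: Gamma_real_pos)
qed

lemma Raabe_formula:
  fixes L :: "real \<Rightarrow> real"
  assumes cont: "continuous_on {0..} L"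
    and der: "\<And>x. x > 0 \<Longrightarrow> (L has_real_derivative ln (Gamma x)) (at x)"
    and "a \<ge> 0"
  shows "L (a + 1) - L a = a * ln a - a + ln (2 * pi) / 2"
proof -
  \<comment> \<open>The functional equation gives \<open>D\<close> derivative 0, and continuity at 0
    identifies the constant with \<open>D 0\<close>, that is \<open>L 1 - L 0\<close>.\<close>
  define D where "D = (\<lambda>x. L (x + 1) - L x - (x ^ Suc 0 * ln x - x))"
  have contD: "continuous_on {0..} D"
    unfolding D_def
    by (intro continuous_intros continuous_on_power_mult_ln cont
        continuous_on_compose2[OF cont]) auto
  have "(D has_real_derivative 0) (at x)" if "x > 0" for x
  proof -
    have "((\<lambda>x. L (x + 1)) has_real_derivative ln (Gamma (x + 1))) (at x)"
      using that by (intro DERIV_chain2[OF der, where Db = 1, simplified])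
        (auto intro!: derivative_eq_intros)
    then have "(D has_real_derivative ln (Gamma (x + 1)) - ln (Gamma x) - (ln x + 1 - 1)) (at x)"
      using der[OF that] that unfolding D_def
      by (intro DERIV_diff) (auto intro!: derivative_eq_intros)
    then show ?thesis
      using ln_Gamma_eq[of x] that by simp
  qed
  then have "D a = D 0"
    using \<open>a \<ge> 0\<close> contD
    by (cases "a = 0")
      (simp, intro DERIV_isconst_end[where f = D], auto elim: continuous_on_subset)
  also have "D 0 = ln (2 * pi) / 2"
  proof -
    \<comment> \<open>\<open>E\<close> is an antiderivative of the difference of the two sides of
      the duplication formula. In \<open>E (1/2) = E 0\<close> the values \<open>L (1/2)\<close>
      cancel and half of \<open>L 1 - L 0\<close> remains.\<close>
    define E where "E = (\<lambda>x. L x + L (x + 1/2) - L (2 * x) / 2 - (x - x\<^sup>2) * ln 2 - x * ln pi / 2)"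
    have "E (1/2) = E 0"
    proof (rule DERIV_isconst_end[where f = E])
      show "continuous_on {0..1/2} E"
        unfolding E_def
        by (intro continuous_intros continuous_on_compose2[OF cont]) auto
      fix x :: real assume x: "0 < x"
      have "((\<lambda>x. L (x + 1/2)) has_real_derivative ln (Gamma (x + 1/2))) (at x)"
        using x by (intro DERIV_chain2[OF der, where Db = 1, simplified])
          (auto intro!: derivative_eq_intros)
      moreover have "((\<lambda>x. L (2 * x)) has_real_derivative ln (Gamma (2 * x)) * 2) (at x)"
        using x by (intro DERIV_chain2[OF der]) (auto intro!: derivative_eq_intros)
      ultimately have "(E has_real_derivative ln (Gamma x) + ln (Gamma (x + 1/2)) -
          ln (Gamma (2 * x)) * 2 / 2 - (1 - 2 * x) * ln 2 - ln pi / 2) (at x)"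
        using der[OF x] unfolding E_def
        by (intro derivative_eq_intros) (auto simp: power2_eq_square)
      then show "(E has_real_derivative 0) (at x)"
        using ln_Gamma_legendre_duplication[OF x] by simp
    qed simp
    then have "L 1 - L 0 = ln 2 / 2 + ln pi / 2"
      by (simp add: E_def power2_eq_square)
    then show ?thesis
      by (simp add: D_def ln_mult add_divide_distrib)
  qed
  finally show ?thesis by (simp add: D_def)
qed

subsection \<open>Integration over the unit cube\<close>

abbreviation unit_interval :: "real measure" where
  "unit_interval \<equiv> restrict_space lborel {0..1}"

interpretation unit_cube: product_sigma_finite "\<lambda>_::nat. unit_interval"
  by (intro product_sigma_finite.intro sigma_finite_measure_restrict_space)
    (auto intro: lborel.sigma_finite_measure_axioms)

lemma integrable_unit_interval_iff:
  "integrable unit_interval f \<longleftrightarrow> set_integrable lborel {0..1} (f :: real \<Rightarrow> real)"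
  by (subst integrable_restrict_space) (auto simp: set_integrable_def)

lemma integral_unit_interval:
  fixes f :: "real \<Rightarrow> real"
  assumes "integrable unit_interval f"
  shows "(LINT x|unit_interval. f x) = integral {0..1} f"
proof -
  have "(LINT x|unit_interval. f x) = (LINT x:{0..1}|lborel. f x)"
    by (subst integral_restrict_space) (auto simp: set_lebesgue_integral_def)
  then show ?thesis
    using assms by (simp add: integrable_unit_interval_iff set_borel_integral_eq_integral)
qed

lemma integrable_unit_interval_const: "integrable unit_interval (\<lambda>_. c :: real)"
  unfolding integrable_unit_interval_iff by (intro borel_integrable_atLeastAtMost') auto

text \<open>The antiderivative x - x log x gives a gauge integral of -log. Since -log is nonnegative
  on [0,1], with \<open>ln 0 = 0\<close>, this is absolute integrability, and Borel measurability
  leads from the completed measure back to \<open>lborel\<close>.\<close>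

lemma integrable_unit_interval_ln: "integrable unit_interval (ln :: real \<Rightarrow> real)"
proof -
  have "((\<lambda>x. - ln x) has_integral (- (1 ^ Suc 0 * ln 1 - 1) - - (0 ^ Suc 0 * ln 0 - 0)))
      {0..1::real}"
    by (rule has_real_derivative_imp_has_integral)
      (auto intro!: continuous_intros continuous_on_power_mult_ln[of 0, simplified]
        derivative_eq_intros)
  moreover have ln_le_zero: "ln x \<le> 0" if "0 \<le> x" "x \<le> 1" for x :: real
    using that by (cases "x = 0") auto
  ultimately have "(\<lambda>x. - ln x) absolutely_integrable_on {0..1::real}"
    by (intro nonnegative_absolutely_integrable_1) (use ln_le_zero in \<open>auto simp: has_integral_iff\<close>)
  then have "set_integrable lborel {0..1::real} (\<lambda>x. - ln x)"
    unfolding set_integrable_def by (subst (asm) integrable_completion) auto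
  then show ?thesis
    by (simp add: integrable_unit_interval_iff set_integrable_def)
qed

lemma integrable_unit_cube_component:
  assumes "integrable unit_interval f" "j \<in> {1..n}"
  shows "integrable (unit_cube n) (\<lambda>x. f (x j) :: real)"
proof -
  \<comment> \<open>A function of one coordinate is a product over all coordinates whose other
    factors are 1.\<close>
  have "integrable (unit_cube n) (\<lambda>x. \<Prod>i=1..n. (if i = j then f else (\<lambda>_. 1)) (x i))"
    using assms integrable_unit_interval_const
    by (intro unit_cube.product_integrable_prod) auto
  also have "(\<lambda>x. \<Prod>i=1..n. (if i = j then f else (\<lambda>_. 1)) (x i)) = (\<lambda>x. f (x j))"
  proof
    fix x
    have "(\<Prod>i=1..n. (if i = j then f else (\<lambda>_. 1)) (x i)) = (\<Prod>i=1..n. if i = j then f (x i) else 1)"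
      by (rule prod.cong) auto
    also have "\<dots> = f (x j)"
      using assms(2) by (subst prod.delta) auto
    finally show "(\<Prod>i=1..n. (if i = j then f else (\<lambda>_. 1)) (x i)) = f (x j)" .
  qed
  finally show ?thesis .
qed

lemma integrable_unit_cube_const: "integrable (unit_cube n) (\<lambda>_. c :: real)"
  and integral_unit_cube_const: "(LINT x|unit_cube n. c) = (c :: real)"
proof -
  have "integrable (unit_cube n) (\<lambda>_. 1::real)"
    using unit_cube.product_integrable_prod[of "{1..n}" "\<lambda>_ _. 1 :: real"]
      integrable_unit_interval_const by simp
  from integrable_mult_right[OF this, of c] show "integrable (unit_cube n) (\<lambda>_. c)" by simp
  have "(LINT x|unit_cube n. (1::real)) = 1"
    using unit_cube.product_integral_prod[of "{1..n}" "\<lambda>_ _. 1 :: real"]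
      integrable_unit_interval_const integral_unit_interval[of "\<lambda>_. 1"] by simp
  moreover have "(LINT x|unit_cube n. c * 1) = c * (LINT x|unit_cube n. (1::real))"
    by (rule integral_mult_right_zero)
  ultimately show "(LINT x|unit_cube n. c) = c" by simp
qed

lemma unit_cube_sum_bounds:
  assumes "x \<in> space (unit_cube n)"
  shows "0 \<le> (\<Sum>i=1..n. x i)" "(\<Sum>i=1..n. x i) \<le> real n"
proof -
  have "x i \<in> {0..1}" if "i \<in> {1..n}" for i
    using assms that by (auto simp: space_PiM PiE_iff space_restrict_space)
  then show "0 \<le> (\<Sum>i=1..n. x i)" "(\<Sum>i=1..n. x i) \<le> real n"
    using sum_bounded_above[of "{1..n}" x 1] by (auto intro!: sum_nonneg)
qed

lemma measurable_unit_cube_component [measurable]: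
  "i \<in> {1..n} \<Longrightarrow> (\<lambda>x. x i) \<in> borel_measurable (unit_cube n)"
  using measurable_component_singleton[of i "{1..n}" "\<lambda>_. unit_interval"]
  by (auto intro: measurable_restrict_space1 simp: measurable_restrict_space2_iff)

lemma measurable_unit_cube_sum [measurable]:
  "(\<lambda>x. \<Sum>i=1..n. x i) \<in> borel_measurable (unit_cube n)"
  by (intro borel_measurable_sum measurable_unit_cube_component)

text \<open>Nothing is known about \<open>f\<close> on negative arguments. Truncating the argument
  gives a function continuous on the whole line that agrees with \<open>f\<close> wherever the cube
  sums lie.\<close>

lemma borel_measurable_max_0:
  assumes "continuous_on {0..} (f :: real \<Rightarrow> real)"
  shows "(\<lambda>x. f (max 0 x)) \<in> borel_measurable borel"
  by (intro borel_measurable_continuous_onI continuous_on_compose2[OF assms] continuous_intros) auto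

text \<open>The argument stays in the compact interval \<open>{a..a+n}\<close>, so \<open>f\<close>
  is bounded there, and constants are integrable over the cube.\<close>

lemma integrable_unit_cube_sum:
  fixes f :: "real \<Rightarrow> real"
  assumes f: "continuous_on {0..} f" and "a \<ge> 0"
  shows "integrable (unit_cube n) (\<lambda>x. f (a + (\<Sum>i=1..n. x i)))"
proof -
  have "compact (f ` {a..a+n})"
    using \<open>a \<ge> 0\<close>
    by (intro compact_continuous_image continuous_on_subset[OF f]) auto
  then obtain B where B: "\<And>y. y \<in> {a..a+n} \<Longrightarrow> \<bar>f y\<bar> \<le> B"
    unfolding real_norm_def[symmetric] by (metis compact_imp_bounded bounded_iff imageI)
  note [measurable] = borel_measurable_max_0[OF f]
  have "integrable (unit_cube n) (\<lambda>x. f (max 0 (a + (\<Sum>i=1..n. x i))))"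
  proof (rule Bochner_Integration.integrable_bound[OF integrable_unit_cube_const[of n B]])
    show "AE x in unit_cube n. norm (f (max 0 (a + (\<Sum>i=1..n. x i)))) \<le> norm B"
    proof (rule AE_I2)
      fix x assume "x \<in> space (unit_cube n)"
      from unit_cube_sum_bounds[OF this] B[of "a + (\<Sum>i=1..n. x i)"] \<open>a \<ge> 0\<close>
      show "norm (f (max 0 (a + (\<Sum>i=1..n. x i)))) \<le> norm B" by (simp add: max_def)
    qed
  qed measurable
  then show ?thesis
    by (rule iffD1[OF Bochner_Integration.integrable_cong, rotated -1])
      (use unit_cube_sum_bounds \<open>a \<ge> 0\<close> in \<open>auto simp: max_def\<close>)
qed

lemma integrable_unit_interval_shift:
  fixes f :: "real \<Rightarrow> real"
  assumes "continuous_on {0..} f" "a \<ge> 0"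
  shows "integrable unit_interval (\<lambda>t. f (a + t))"
  unfolding integrable_unit_interval_iff
  using assms by (intro borel_integrable_atLeastAtMost' continuous_on_compose2[OF assms(1)]
      continuous_intros) auto

text \<open>Fubini, with the last coordinate innermost.\<close>

lemma integral_unit_cube_Suc:
  fixes f :: "real \<Rightarrow> real"
  assumes "integrable (unit_cube (Suc m)) (\<lambda>x. f (\<Sum>i=1..Suc m. x i))"
  shows "(LINT x|unit_cube (Suc m). f (\<Sum>i=1..Suc m. x i)) =
    (LINT x|unit_cube m. LINT t|unit_interval. f ((\<Sum>i=1..m. x i) + t))"
proof -
  have eq: "{1..Suc m} = insert (Suc m) {1..m}" by auto
  have "(LINT x|unit_cube (Suc m). f (\<Sum>i=1..Suc m. x i)) =
      (LINT x|unit_cube m. LINT t|unit_interval. f (\<Sum>i=1..Suc m. (x(Suc m := t)) i))"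
    using assms unfolding eq by (intro unit_cube.product_integral_insert) auto
  moreover have "(\<Sum>i=1..Suc m. (x(Suc m := t)) i) = (\<Sum>i=1..m. x i) + t" for x and t :: real
    by (auto intro!: sum.cong)
  ultimately show ?thesis by (simp only:)
qed

section \<open>Iterated antiderivatives and forward differences\<close>

text \<open>Pascal's rule: the difference of order m+1 at 0 is the m-th difference of
  \<open>f (Suc k) - f k\<close>.\<close>

lemma forward_difference_Suc:
  fixes f :: "nat \<Rightarrow> real"
  shows "(\<Sum>k\<le>Suc m. (-1) ^ (Suc m + k) * real (Suc m choose k) * f k) =
    (\<Sum>k\<le>m. (-1) ^ (m + k) * real (m choose k) * (f (Suc k) - f k))"
proof -
  have "(\<Sum>k\<le>Suc m. (-1) ^ (Suc m + k) * real (Suc m choose k) * f k) =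
      (-1) ^ Suc m * f 0 + (\<Sum>k\<le>m. (-1) ^ (m + k) * real (Suc m choose Suc k) * f (Suc k))"
    by (subst sum.atMost_Suc_shift) simp
  also have "\<dots> = (\<Sum>k\<le>m. (-1) ^ (m + k) * real (m choose k) * f (Suc k)) -
      ((-1) ^ m * f 0 + (\<Sum>k\<le>m. (-1) ^ (m + Suc k) * real (m choose Suc k) * f (Suc k)))"
    by (simp add: algebra_simps sum.distrib sum_negf)
  also have "(-1) ^ m * f 0 + (\<Sum>k\<le>m. (-1) ^ (m + Suc k) * real (m choose Suc k) * f (Suc k)) =
      (\<Sum>k\<le>Suc m. (-1) ^ (m + k) * real (m choose k) * f k)"
    by (subst sum.atMost_Suc_shift) simp
  \<comment> \<open>The top term vanishes because \<open>m choose Suc m\<close> is 0.\<close>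
  also have "\<dots> = (\<Sum>k\<le>m. (-1) ^ (m + k) * real (m choose k) * f k)"
    by simp
  finally show ?thesis
    by (simp add: algebra_simps sum_subtractf)
qed

text \<open>Integrating out one coordinate replaces \<open>F j\<close> by a unit difference of
  \<open>F (Suc j)\<close>. The offset \<open>a\<close> is general because the induction hypothesis
  is used at both \<open>a + 1\<close> and \<open>a\<close>.\<close>

lemma integral_unit_cube_sum:
  fixes F :: "nat \<Rightarrow> real \<Rightarrow> real"
  assumes cont: "\<And>j. continuous_on {0..} (F j)"
    and der: "\<And>j x. x > 0 \<Longrightarrow> (F (Suc j) has_real_derivative F j x) (at x)"
    and "a \<ge> 0"
  shows "(LINT x|unit_cube m. F j (a + (\<Sum>i=1..m. x i))) =
    (\<Sum>k\<le>m. (-1) ^ (m + k) * real (m choose k) * F (m + j) (a + real k))"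
  using \<open>a \<ge> 0\<close>
proof (induction m arbitrary: j a)
  case 0
  show ?case
    using integral_unit_cube_const[of 0 "F j a"] by simp
next
  case (Suc m)
  note a = \<open>a \<ge> 0\<close>
  have "(LINT x|unit_cube (Suc m). F j (a + (\<Sum>i=1..Suc m. x i))) =
      (LINT x|unit_cube m. LINT t|unit_interval. F j (a + ((\<Sum>i=1..m. x i) + t)))"
    by (intro integral_unit_cube_Suc[of m "\<lambda>s. F j (a + s)"] integrable_unit_cube_sum cont a)
  also have "\<dots> = (LINT x|unit_cube m. F (Suc j) (a + 1 + (\<Sum>i=1..m. x i)) -
      F (Suc j) (a + (\<Sum>i=1..m. x i)))"
  proof (rule Bochner_Integration.integral_cong[OF refl])
    fix x assume x: "x \<in> space (unit_cube m)"
    define s where "s = a + (\<Sum>i=1..m. x i)"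
    have s: "s \<ge> 0"
      using unit_cube_sum_bounds[OF x] a by (simp add: s_def)
    have "(F j has_integral F (Suc j) (s + 1) - F (Suc j) s) {s..s + 1}"
      using s by (intro has_real_derivative_imp_has_integral cont der) auto
    \<comment> \<open>Translation by \<open>s\<close> carries the integral over
      \<open>{s..s + 1}\<close> to [0,1].\<close>
    from has_integral_affinity'[of "F j" _ s "s + 1" 1 s, simplified, OF this]
    have "integral {0..1} (\<lambda>t. F j (s + t)) = F (Suc j) (s + 1) - F (Suc j) s"
      by (simp add: add.commute integral_unique)
    then show "(LINT t|unit_interval. F j (a + ((\<Sum>i=1..m. x i) + t))) =
        F (Suc j) (a + 1 + (\<Sum>i=1..m. x i)) - F (Suc j) (a + (\<Sum>i=1..m. x i))"
      using integral_unit_interval[OF integrable_unit_interval_shift[OF cont s]]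
      by (simp add: s_def add_ac)
  qed
  also have "\<dots> = (LINT x|unit_cube m. F (Suc j) (a + 1 + (\<Sum>i=1..m. x i))) -
      (LINT x|unit_cube m. F (Suc j) (a + (\<Sum>i=1..m. x i)))"
    using a by (intro Bochner_Integration.integral_diff integrable_unit_cube_sum cont) auto
  also have "\<dots> = (\<Sum>k\<le>m. (-1) ^ (m + k) * real (m choose k) *
      (F (Suc m + j) (a + real (Suc k)) - F (Suc m + j) (a + real k)))"
    using Suc.IH[of "a + 1" "Suc j"] Suc.IH[of a "Suc j"] a
    by (simp add: sum_subtractf right_diff_distrib add_ac)
  also have "\<dots> = (\<Sum>k\<le>Suc m. (-1) ^ (Suc m + k) * real (Suc m choose k) * F (Suc m + j) (a + real k))"
    by (rule forward_difference_Suc[symmetric])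
  finally show ?case .
qed

text \<open>Each coordinate contributes its mean 1/2.\<close>

lemma expectation_unit_cube_sum: "(LINT x|unit_cube m. (\<Sum>i=1..m. x i)) = real m / 2"
proof (induction m)
  case (Suc m)
  have "(LINT t|unit_interval. s + t) = s + 1 / 2" if "s \<ge> 0" for s :: real
  proof -
    have "((\<lambda>t. s + t) has_integral (s * 1 + 1\<^sup>2 / 2) - (s * 0 + 0\<^sup>2 / 2)) {0..1}"
      by (rule has_real_derivative_imp_has_integral)
        (auto intro!: continuous_intros derivative_eq_intros)
    then show ?thesis
      using integral_unit_interval[OF integrable_unit_interval_shift[of "\<lambda>x. x" s]] that
      by (simp add: integral_unique)
  qed
  then have "(LINT x|unit_cube (Suc m). (\<Sum>i=1..Suc m. x i)) =
      (LINT x|unit_cube m. (\<Sum>i=1..m. x i) + 1 / 2)"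
    using integrable_unit_cube_sum[of "\<lambda>x. x" 0 "Suc m"]
    by (subst integral_unit_cube_Suc[of m "\<lambda>x. x"])
      (auto intro!: Bochner_Integration.integral_cong dest: unit_cube_sum_bounds simp del: One_nat_def)
  also have "\<dots> = (LINT x|unit_cube m. (\<Sum>i=1..m. x i)) + (LINT x|unit_cube m. 1 / 2)"
    using integrable_unit_cube_sum[of "\<lambda>x. x" 0 m]
    by (intro Bochner_Integration.integral_add integrable_unit_cube_const) auto
  finally show ?case
    unfolding integral_unit_cube_const Suc.IH by (simp add: add_divide_distrib)
qed simp

text \<open>The \<open>m\<close>-th difference of \<open>x\<^sup>m\<^sup>+\<^sup>1\<close> is read off from the expectation of a sum of \<open>m\<close>
  independent uniform variables.\<close>

lemma alternating_sum_choose_power_Suc: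
  "(\<Sum>k\<le>m. (-1) ^ (m + k) * real (m choose k) * real k ^ Suc m) = fact (Suc m) * (real m / 2)"
proof -
  \<comment> \<open>Iterated antiderivatives of the identity \<open>F 0\<close>.\<close>
  define F :: "nat \<Rightarrow> real \<Rightarrow> real" where "F = (\<lambda>j x. x ^ Suc j / fact (Suc j))"
  have "(LINT x|unit_cube m. F 0 (0 + (\<Sum>i=1..m. x i))) =
      (\<Sum>k\<le>m. (-1) ^ (m + k) * real (m choose k) * F (m + 0) (0 + real k))"
  proof (rule integral_unit_cube_sum)
    show "continuous_on {0..} (F j)" for j
      unfolding F_def by (intro continuous_intros) auto
    show "(F (Suc j) has_real_derivative F j x) (at x)" for j x
      unfolding F_def fact_Suc[of "Suc j"]
      by (auto intro!: derivative_eq_intros simp: divide_simps simp del: fact_Suc power_Suc)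
  qed simp
  then have "real m / 2 =
      (\<Sum>k\<le>m. (-1) ^ (m + k) * real (m choose k) * real k ^ Suc m / fact (Suc m))"
    using expectation_unit_cube_sum[of m] by (simp add: F_def del: fact_Suc power_Suc)
  then show ?thesis
    unfolding sum_divide_distrib[symmetric] by (simp add: field_simps del: fact_Suc power_Suc)
qed

lemma integral_unit_cube_x_ln_x:
  "(LINT x|unit_cube m. (\<Sum>i=1..m. x i) * ln (\<Sum>i=1..m. x i) - (\<Sum>i=1..m. x i)) =
    (\<Sum>k=2..m. (-1) ^ (m + k) * real k ^ Suc m / fact (Suc m) * real (m choose k) * ln (real k))
      - real m / 2 * harm (Suc m)"
proof -
  \<comment> \<open>\<open>F 0\<close> is s log s - s. Differentiating the logarithm in
    \<open>F (Suc j)\<close> leaves an extra \<open>x ^ Suc j / fact (Suc (Suc j))\<close>, which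
    lowers the harmonic number by 1/(j+2), from H_(j+2) to H_(j+1).\<close>
  define F :: "nat \<Rightarrow> real \<Rightarrow> real" where
    "F = (\<lambda>j x. x ^ Suc j * ln x / fact (Suc j) - harm (Suc j) / fact (Suc j) * x ^ Suc j)"
  have "(LINT x|unit_cube m. F 0 (0 + (\<Sum>i=1..m. x i))) =
      (\<Sum>k\<le>m. (-1) ^ (m + k) * real (m choose k) * F (m + 0) (0 + real k))"
  proof (rule integral_unit_cube_sum)
    show "continuous_on {0..} (F j)" for j
      unfolding F_def
      by (intro continuous_intros continuous_on_power_mult_ln) auto
    show "(F (Suc j) has_real_derivative F j x) (at x)" if "x > 0" for j x
    proof -
      have "(F (Suc j) has_real_derivative
          (real (Suc (Suc j)) * x ^ Suc j * ln x + x ^ Suc (Suc j) * (1 / x)) / fact (Suc (Suc j))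
          - harm (Suc (Suc j)) / fact (Suc (Suc j)) * (real (Suc (Suc j)) * x ^ Suc j)) (at x)"
        unfolding F_def using that
        by (intro derivative_eq_intros) (auto simp del: fact_Suc power_Suc)
      also have "x ^ Suc (Suc j) * (1 / x) = x ^ Suc j"
        using that by simp
      also have "(real (Suc (Suc j)) * x ^ Suc j * ln x + x ^ Suc j) / fact (Suc (Suc j))
          - harm (Suc (Suc j)) / fact (Suc (Suc j)) * (real (Suc (Suc j)) * x ^ Suc j) = F j x"
        unfolding F_def fact_Suc[of "Suc j"] harm_Suc[of "Suc j"]
        by (simp add: field_simps del: fact_Suc power_Suc of_nat_Suc)
      finally show ?thesis .
    qed
  qed simp
  \<comment> \<open>The harmonic part is a multiple of the m-th difference of x^(m+1), which is
    already evaluated.\<close>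
  also have "\<dots> = (\<Sum>k\<le>m. (-1) ^ (m + k) * real k ^ Suc m / fact (Suc m) * real (m choose k) * ln (real k))
      - harm (Suc m) / fact (Suc m) *
        (\<Sum>k\<le>m. (-1) ^ (m + k) * real (m choose k) * real k ^ Suc m)"
    unfolding F_def sum_distrib_left sum_subtractf[symmetric]
    by (intro sum.cong) (simp_all add: field_simps del: fact_Suc power_Suc)
  also have "harm (Suc m) / fact (Suc m) *
      (\<Sum>k\<le>m. (-1) ^ (m + k) * real (m choose k) * real k ^ Suc m) = real m / 2 * harm (Suc m)"
    unfolding alternating_sum_choose_power_Suc by (simp del: fact_Suc)
  \<comment> \<open>The terms for k = 0 and k = 1 vanish, as 0 has a positive power and
    \<open>ln 1 = 0\<close>.\<close>
  also have "(\<Sum>k\<le>m. (-1) ^ (m + k) * real k ^ Suc m / fact (Suc m) * real (m choose k) * ln (real k)) =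
      (\<Sum>k=2..m. (-1) ^ (m + k) * real k ^ Suc m / fact (Suc m) * real (m choose k) * ln (real k))"
  proof (rule sum.mono_neutral_right)
    show "\<forall>k\<in>{..m} - {2..m}.
        (-1) ^ (m + k) * real k ^ Suc m / fact (Suc m) * real (m choose k) * ln (real k) = 0"
    proof
      fix k assume "k \<in> {..m} - {2..m}"
      then have "k = 0 \<or> k = 1" by auto
      then show "(-1) ^ (m + k) * real k ^ Suc m / fact (Suc m) * real (m choose k) * ln (real k) = 0"
        by auto
    qed
  qed auto
  finally show ?thesis
    by (simp add: F_def harm_expand)
qed

section \<open>Integrability of log Gamma and conclusion\<close>

text \<open>By \<open>ln_Gamma_eq\<close> only \<open>ln (a + t)\<close> can be singular; it is
  continuous for a > 0 and covered by the integrability of log for a = 0.\<close>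

lemma integrable_unit_interval_ln_Gamma_shift:
  fixes a :: real
  assumes "a \<ge> 0"
  shows "integrable unit_interval (\<lambda>t. ln (Gamma (a + t)))"
proof -
  have "integrable unit_interval (\<lambda>t. ln (a + t))"
  proof (cases "a = 0")
    case False
    with assms show ?thesis
      unfolding integrable_unit_interval_iff
      by (intro borel_integrable_atLeastAtMost' continuous_intros) auto
  qed (simp add: integrable_unit_interval_ln)
  then have "integrable unit_interval (\<lambda>t. ln (Gamma (a + t + 1)) - ln (a + t))"
    using integrable_unit_interval_shift[OF continuous_on_ln_Gamma_Suc assms]
    by (intro Bochner_Integration.integrable_diff)
  then show ?thesis
    by (rule iffD1[OF Bochner_Integration.integrable_cong, rotated -1])
      (use assms in \<open>auto simp: space_restrict_space ln_Gamma_eq[symmetric]\<close>)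
qed

text \<open>Near the origin \<open>\<bar>ln (\<Sum>i. x i)\<bar> \<le> \<bar>ln (x j)\<bar>\<close> for any \<open>j\<close> with \<open>x j > 0\<close>.  At the origin
  itself \<open>ln 0 = 0\<close>, so the bound needs no exceptional null set.\<close>

lemma integrable_unit_cube_ln_sum: "integrable (unit_cube n) (\<lambda>x. ln (\<Sum>i=1..n. x i))"
proof (rule Bochner_Integration.integrable_bound)
  show "integrable (unit_cube n) (\<lambda>x. real n + (\<Sum>j=1..n. \<bar>ln (x j)\<bar>))"
    by (intro Bochner_Integration.integrable_add Bochner_Integration.integrable_sum
        integrable_unit_cube_const integrable_unit_cube_component[of "\<lambda>y. \<bar>ln y\<bar>"]
        integrable_abs integrable_unit_interval_ln)
  show "AE x in unit_cube n. norm (ln (\<Sum>i=1..n. x i)) \<le> norm (real n + (\<Sum>j=1..n. \<bar>ln (x j)\<bar>))"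
  proof (rule AE_I2)
    fix x assume x: "x \<in> space (unit_cube n)"
    define s where "s = (\<Sum>i=1..n. x i)"
    have s: "0 \<le> s" "s \<le> real n"
      using unit_cube_sum_bounds[OF x] by (simp_all add: s_def)
    have x_nonneg: "x i \<ge> 0" if "i \<in> {1..n}" for i
      using x that by (auto simp: space_PiM PiE_iff space_restrict_space)
    have "\<bar>ln s\<bar> \<le> real n + (\<Sum>j=1..n. \<bar>ln (x j)\<bar>)"
    proof (cases "s = 0")
      case False
      then obtain j where j: "j \<in> {1..n}" "x j \<noteq> 0"
        unfolding s_def by (meson sum.neutral)
      have "0 < x j" "x j \<le> s"
        using j x_nonneg by (auto simp: s_def order_less_le intro!: member_le_sum)
      then have "ln (x j) \<le> ln s"
        by simp
      moreover have "\<bar>ln (x j)\<bar> \<le> (\<Sum>j=1..n. \<bar>ln (x j)\<bar>)"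
        using j by (intro member_le_sum) auto
      moreover have "ln s \<le> s"
        using False s ln_le_minus_one[of s] by simp
      ultimately show ?thesis
        using s by linarith
    qed (simp add: sum_nonneg)
    then show "norm (ln (\<Sum>i=1..n. x i)) \<le> norm (real n + (\<Sum>j=1..n. \<bar>ln (x j)\<bar>))"
      by (simp add: s_def)
  qed
qed measurable

theorem theorem1p2:
  fixes n :: nat
  assumes "n \<ge> 1"
  shows "integrable (unit_cube n) (\<lambda>x. ln (Gamma (\<Sum>i=1..n. x i))) \<and>
    (LINT x|unit_cube n. ln (Gamma (\<Sum>i=1..n. x i))) =
      1 / 2 * ln (2 * pi) - (real n - 1) / 2 * harm n
      + (\<Sum>k=2..n-1. (-1) ^ (n + k + 1) * real k ^ n / fact n * real ((n - 1) choose k) * ln (real k))"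
proof
  \<comment> \<open>The same splitting as on the interval, with \<open>ln\<close> of the sum as
    singular part; the identity also holds where the sum is 0.\<close>
  have "integrable (unit_cube n)
      (\<lambda>x. ln (Gamma ((\<Sum>i=1..n. x i) + 1)) - ln (\<Sum>i=1..n. x i))"
    using integrable_unit_cube_sum[OF continuous_on_ln_Gamma_Suc, of 0 n]
    by (intro Bochner_Integration.integrable_diff integrable_unit_cube_ln_sum) simp
  then show int: "integrable (unit_cube n) (\<lambda>x. ln (Gamma (\<Sum>i=1..n. x i)))"
    by (rule iffD1[OF Bochner_Integration.integrable_cong, rotated -1])
      (auto simp: ln_Gamma_eq[symmetric] unit_cube_sum_bounds simp del: One_nat_def)

  \<comment> \<open>One coordinate is spent on Raabe's formula; the other m remain for the integral
    of s log s - s.\<close>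
  obtain m where n: "n = Suc m"
    using assms by (cases n) auto
  let ?S = "\<lambda>x. \<Sum>i=1..m. x i :: real"
  obtain L where L: "continuous_on {0..} L"
    "\<And>x. x > 0 \<Longrightarrow> (L has_real_derivative ln (Gamma x)) (at x)"
    using ln_Gamma_antiderivative by blast
  have inner: "(LINT t|unit_interval. ln (Gamma (s + t))) = s * ln s - s + ln (2 * pi) / 2"
    if s: "s \<ge> 0" for s
  proof -
    have "((\<lambda>x. ln (Gamma x)) has_integral L (s + 1) - L s) {s..s + 1}"
      using s by (intro has_real_derivative_imp_has_integral L) auto
    from has_integral_affinity'[of _ _ s "s + 1" 1 s, simplified, OF this]
    show ?thesis
      using integral_unit_interval[OF integrable_unit_interval_ln_Gamma_shift[OF s]] Raabe_formula[OF L s]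
      by (simp add: add.commute integral_unique)
  qed
  have "continuous_on {0..} (\<lambda>x::real. x ^ Suc 0 * ln x - x)"
    by (intro continuous_intros continuous_on_power_mult_ln)
  from integrable_unit_cube_sum[OF this, of 0 m]
  have "integrable (unit_cube m) (\<lambda>x. ?S x * ln (?S x) - ?S x)"
    by simp
  then have "(LINT x|unit_cube m. ?S x * ln (?S x) - ?S x + ln (2 * pi) / 2) =
      (LINT x|unit_cube m. ?S x * ln (?S x) - ?S x) + ln (2 * pi) / 2"
    by (subst Bochner_Integration.integral_add)
      (simp_all only: integrable_unit_cube_const integral_unit_cube_const)
  moreover have "(LINT x|unit_cube n. ln (Gamma (\<Sum>i=1..n. x i))) =
      (LINT x|unit_cube m. ?S x * ln (?S x) - ?S x + ln (2 * pi) / 2)"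
    using int unfolding n
    by (subst integral_unit_cube_Suc)
      (auto intro!: Bochner_Integration.integral_cong inner unit_cube_sum_bounds
        simp del: One_nat_def)
  \<comment> \<open>Since n = m+1, the exponent n+k+1 is m+k+2, of the parity of m+k.\<close>
  moreover have "(- 1 :: real) ^ (Suc m + k + 1) = (- 1) ^ (m + k)" for k
    by simp
  ultimately show "(LINT x|unit_cube n. ln (Gamma (\<Sum>i=1..n. x i))) =
      1 / 2 * ln (2 * pi) - (real n - 1) / 2 * harm n
      + (\<Sum>k=2..n-1. (-1) ^ (n + k + 1) * real k ^ n / fact n * real ((n - 1) choose k) * ln (real k))"
    unfolding integral_unit_cube_x_ln_x n by (simp only:) simp
qed

end
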